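(* Let $\mathcal M$ be a $C^1$-Banach manifold, let $x\in\mathcal M$, let $f\colon\mathcal M\to\mathbb R\cup\{+\infty\}$ be lower semi-continuous, and suppose that $x^*\in\partial_F f(x)$. (1) There exist $\varphi\in C^1(\mathcal M)$ and an open neighborhood $\mathcal V$ of $x$ such that $\varphi'(x)=x^*$ and $$(f+\iota_{\mathcal V})^\star(\varphi)=\varphi(x)-f(x).$$ (2) Assume, in addition, that $\mathcal M$ admits $C^1$-partitions of unity. Then there exists $\psi\in C^1(\mathcal M)$ such that $\psi'(x)=x^*$ and $$f^\star(\psi)=\psi(x)-f(x).$$
   Context: $C^1(\mathcal M)$ is the space of real-valued $C^1$-functions on $\mathcal M$, where $\mathcal M$ is a $C^1$-manifold modeled on a real Banach space. A function $f\colon\mathcal M\to\mathbb R\cup\{+\infty\}$ is lower semi-continuous if $\{f>r\}$ is open for every $r\in\mathbb R$. Viscosity Fréchet subdifferential: if $f(x)\ne+\infty$, $\partial_F f(x):=\{\varphi'(x):\varphi\in C^1(\mathcal M),\ f-\varphi\text{ attains a local minimum at }x\}\subseteq T_x^*\mathcal M$, where $T^*_x\mathcal M$ is the topological dual of the tangent space; if $f(x)=+\infty$, $\partial_F f(x):=\emptyset$. Nonlinear Fenchel conjugate: for $h\colon\mathcal M\to\mathbb R\cup\{+\infty\}$ and $\varphi\colon\mathcal M\to\mathbb R$, $h^\star(\varphi):=\sup_{y\in\mathcal M}\{\varphi(y)-h(y)\}\in\mathbb R\cup\{\pm\infty\}$. The indicator function $\iota_{\mathcal V}$ is $0$ on $\mathcal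 V$ and $+\infty$ elsewhere, so $(f+\iota_{\mathcal V})^\star(\varphi)=\sup_{y\in\mathcal V}\{\varphi(y)-f(y)\}$. $\mathcal M$ admits $C^1$-partitions of unity if for every open cover $\{\mathcal O_\lambda\}_{\lambda\in\Lambda}$ of $\mathcal M$ there are $C^1$-functions $\varphi_\lambda\colon\mathcal M\to[0,1]$, $\lambda\in\Lambda$, with $\operatorname{supp}\varphi_\lambda\subseteq\mathcal O_\lambda$, such that every point has a neighborhood meeting only finitely many of the supports, and $\sum_\lambda\varphi_\lambda(x)=1$ for all $x\in\mathcal M$. *)

theory Defs
  imports "HOL-Analysis.Analysis"
begin

section \<open>Banach manifolds of class C1\<close>

text \<open>
  A map of class C1 on an open set \<open>S\<close>: Frechet differentiable at every point of \<open>S\<close>, with a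
  derivative that is continuous for the operator norm.
\<close>

definition C1_on :: "('a::real_normed_vector \<Rightarrow> 'b::real_normed_vector) \<Rightarrow> 'a set \<Rightarrow> bool" where
  "C1_on g S \<longleftrightarrow> (\<exists>g' :: 'a \<Rightarrow> 'a \<Rightarrow>\<^sub>L 'b.
     (\<forall>p\<in>S. (g has_derivative blinfun_apply (g' p)) (at p)) \<and> continuous_on S g')"

text \<open>
  A chart is a pair \<open>(U, \<kappa>)\<close> of its domain and its coordinate map; values of \<open>\<kappa>\<close> outside \<open>U\<close> are
  irrelevant.
\<close>

type_synonym ('m, 'e) chart = "'m set \<times> ('m \<Rightarrow> 'e)"

definition chart_on :: "'m topology \<Rightarrow> ('m, 'e::banach) chart \<Rightarrow> bool" where
  "chart_on X = (\<lambda>(U, \<kappa>). openin X U \<and> open (\<kappa> ` U) \<and>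
     homeomorphic_map (subtopology X U) (top_of_set (\<kappa> ` U)) \<kappa>)"

text \<open>The representation \<open>g \<circ> \<kappa>\<inverse>\<close> of a map in a chart; meaningful on \<open>\<kappa> ` U\<close> only.\<close>

definition in_chart :: "('m, 'e) chart \<Rightarrow> ('m \<Rightarrow> 'b) \<Rightarrow> 'e \<Rightarrow> 'b" where
  "in_chart c g = g \<circ> inv_into (fst c) (snd c)"

text \<open>
  The manifold is the set \<open>topspace X\<close> with the topology \<open>X\<close> and the (not necessarily maximal) C1
  atlas \<open>A\<close>.  Being Hausdorff or second countable is not part of the definition.
\<close>

definition C1_banach_manifold :: "'m topology \<Rightarrow> ('m, 'e::banach) chart set \<Rightarrow> bool" where
  "C1_banach_manifold X A \<longleftrightarrow>
     (\<forall>c\<in>A. chart_on X c) \<and>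
     (\<Union>c\<in>A. fst c) = topspace X \<and>
     (\<forall>c\<in>A. \<forall>d\<in>A. C1_on (in_chart c (snd d)) (snd c ` (fst c \<inter> fst d)))"

definition C1_functions :: "('m, 'e::banach) chart set \<Rightarrow> ('m \<Rightarrow> real) set" where
  "C1_functions A = {\<phi>. \<forall>c\<in>A. C1_on (in_chart c \<phi>) (snd c ` fst c)}"


section \<open>Tangent and cotangent spaces, derivatives of functions\<close>

text \<open>
  A tangent vector at \<open>x\<close> is an equivalence class of pairs \<open>(c, v)\<close>, where \<open>v\<close> is a vector of the
  model space read in the chart \<open>c\<close> around \<open>x\<close>; two pairs are equivalent if the derivative of the
  change of charts maps the one vector to the other.
\<close>

type_synonym ('m, 'e) tangent = "(('m, 'e) chart \<times> 'e) set"

definition tangent_rel ::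
    "('m, 'e::banach) chart set \<Rightarrow> 'm \<Rightarrow> ((('m, 'e) chart \<times> 'e) \<times> (('m, 'e) chart \<times> 'e)) set" where
  "tangent_rel A x = {((c, v), (d, w)) | c v d w.
     c \<in> A \<and> d \<in> A \<and> x \<in> fst c \<and> x \<in> fst d \<and>
     frechet_derivative (in_chart c (snd d)) (at (snd c x)) v = w}"

definition tangent_space :: "('m, 'e::banach) chart set \<Rightarrow> 'm \<Rightarrow> ('m, 'e) tangent set" where
  "tangent_space A x = ({c \<in> A. x \<in> fst c} \<times> UNIV) // tangent_rel A x"

definition tangent_vector ::
    "('m, 'e::banach) chart set \<Rightarrow> 'm \<Rightarrow> ('m, 'e) chart \<Rightarrow> 'e \<Rightarrow> ('m, 'e) tangent" where
  "tangent_vector A x c v = tangent_rel A x `` {(c, v)}"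

text \<open>
  The topological dual of the tangent space.  The structure of a topological vector space on
  \<open>tangent_space A x\<close> is the one that makes \<open>tangent_vector A x c\<close> a linear homeomorphism for each
  chart \<open>c\<close> around \<open>x\<close>.  Functionals are \<open>undefined\<close> outside the tangent space, so that equality of
  functions is equality of functionals.
\<close>

definition cotangent_space ::
    "('m, 'e::banach) chart set \<Rightarrow> 'm \<Rightarrow> (('m, 'e) tangent \<Rightarrow> real) set" where
  "cotangent_space A x = {l \<in> extensional (tangent_space A x).
     \<forall>c\<in>A. x \<in> fst c \<longrightarrow> bounded_linear (\<lambda>v. l (tangent_vector A x c v))}"

text \<open>
  The derivative \<open>\<phi>'(x)\<close>, given on the class of \<open>(c, v)\<close> by the derivative of \<open>\<phi> \<circ> \<kappa>\<inverse>\<close> at \<open>\<kappa> x\<close> in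
  direction \<open>v\<close>; independence of the representative is \<open>manifold_derivative_tangent_vector\<close>.
\<close>

definition manifold_derivative ::
    "('m, 'e::banach) chart set \<Rightarrow> ('m \<Rightarrow> real) \<Rightarrow> 'm \<Rightarrow> ('m, 'e) tangent \<Rightarrow> real" where
  "manifold_derivative A \<phi> x = restrict
     (\<lambda>\<xi>. THE r. \<forall>(c, v)\<in>\<xi>. r = frechet_derivative (in_chart c \<phi>) (at (snd c x)) v)
     (tangent_space A x)"


section \<open>Lower semi-continuity, subdifferential and conjugate\<close>

definition lower_semicontinuous :: "'m topology \<Rightarrow> ('m \<Rightarrow> ereal) \<Rightarrow> bool" where
  "lower_semicontinuous X f \<longleftrightarrow> (\<forall>r::real. openin X {y \<in> topspace X. f y > ereal r})"

definition local_min_at :: "'m topology \<Rightarrow> ('m \<Rightarrow> ereal) \<Rightarrow> 'm \<Rightarrow> bool" where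
  "local_min_at X h x \<longleftrightarrow> (\<exists>W. openin X W \<and> x \<in> W \<and> (\<forall>y\<in>W. h x \<le> h y))"

definition frechet_subdifferential ::
    "'m topology \<Rightarrow> ('m, 'e::banach) chart set \<Rightarrow> ('m \<Rightarrow> ereal) \<Rightarrow> 'm \<Rightarrow> (('m, 'e) tangent \<Rightarrow> real) set" where
  "frechet_subdifferential X A f x =
     (if f x \<noteq> \<infinity> then {manifold_derivative A \<phi> x | \<phi>.
        \<phi> \<in> C1_functions A \<and> local_min_at X (\<lambda>y. f y - ereal (\<phi> y)) x} else {})"

definition fenchel_conjugate :: "'m topology \<Rightarrow> ('m \<Rightarrow> ereal) \<Rightarrow> ('m \<Rightarrow> real) \<Rightarrow> ereal" where
  "fenchel_conjugate X h \<phi> = (SUP y\<in>topspace X. ereal (\<phi> y) - h y)"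

definition indicator_function :: "'m set \<Rightarrow> 'm \<Rightarrow> ereal" where
  "indicator_function V y = (if y \<in> V then 0 else \<infinity>)"


section \<open>Partitions of unity\<close>

definition supp :: "'m topology \<Rightarrow> ('m \<Rightarrow> real) \<Rightarrow> 'm set" where
  "supp X \<phi> = X closure_of {y \<in> topspace X. \<phi> y \<noteq> 0}"

definition open_cover :: "'m topology \<Rightarrow> 'i set \<Rightarrow> ('i \<Rightarrow> 'm set) \<Rightarrow> bool" where
  "open_cover X \<Lambda> \<O> \<longleftrightarrow> (\<forall>i\<in>\<Lambda>. openin X (\<O> i)) \<and> (\<Union>i\<in>\<Lambda>. \<O> i) = topspace X"

text \<open>The sum below has finitely many nonzero terms, by local finiteness.\<close>

definition C1_partition_of_unity ::
    "'m topology \<Rightarrow> ('m, 'e::banach) chart set \<Rightarrow> 'i set \<Rightarrow> ('i \<Rightarrow> 'm set) \<Rightarrow> ('i \<Rightarrow> 'm \<Rightarrow> real) \<Rightarrow> bool" where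
  "C1_partition_of_unity X A \<Lambda> \<O> \<rho> \<longleftrightarrow>
     (\<forall>i\<in>\<Lambda>. \<rho> i \<in> C1_functions A \<and> \<rho> i ` topspace X \<subseteq> {0..1} \<and> supp X (\<rho> i) \<subseteq> \<O> i) \<and>
     (\<forall>y\<in>topspace X. \<exists>W. openin X W \<and> y \<in> W \<and> finite {i \<in> \<Lambda>. supp X (\<rho> i) \<inter> W \<noteq> {}}) \<and>
     (\<forall>y\<in>topspace X. (\<Sum>i | i \<in> \<Lambda> \<and> \<rho> i y \<noteq> 0. \<rho> i y) = 1)"

text \<open>
  Index types cannot be quantified inside a definition, so the covers here are sets of open sets,
  indexed by themselves.  Covers indexed by any other type are then served as well: see
  \<open>admits_C1_partitions_of_unity_indexed\<close>.
\<close>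

definition admits_C1_partitions_of_unity :: "'m topology \<Rightarrow> ('m, 'e::banach) chart set \<Rightarrow> bool" where
  "admits_C1_partitions_of_unity X A \<longleftrightarrow>
     (\<forall>\<C> :: 'm set set. open_cover X \<C> (\<lambda>U. U) \<longrightarrow> (\<exists>\<rho>. C1_partition_of_unity X A \<C> (\<lambda>U. U) \<rho>))"

lemma zero_in_C1_functions: "(\<lambda>_. 0) \<in> C1_functions A"
proof -
  have "C1_on (in_chart c (\<lambda>_. 0::real)) S" for c :: "('a, 'b) chart" and S
    unfolding C1_on_def in_chart_def o_def
    by (rule exI[of _ "\<lambda>_. 0"]) (auto intro!: derivative_eq_intros)
  then show ?thesis by (simp add: C1_functions_def)
qed

lemma admits_C1_partitions_of_unity_indexed:
  fixes \<Lambda> :: "'i set" and \<O> :: "'i \<Rightarrow> 'm set" and A :: "('m, 'e::banach) chart set"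
  assumes "admits_C1_partitions_of_unity X A" and "open_cover X \<Lambda> \<O>"
  shows "\<exists>\<rho>. C1_partition_of_unity X A \<Lambda> \<O> \<rho>"
proof -
  have "open_cover X (\<O> ` \<Lambda>) (\<lambda>U. U)"
    using assms(2) by (auto simp: open_cover_def)
  then obtain \<sigma> where \<sigma>: "C1_partition_of_unity X A (\<O> ` \<Lambda>) (\<lambda>U. U) \<sigma>"
    using assms(1) unfolding admits_C1_partitions_of_unity_def by blast
  define J where "J = inv_into \<Lambda> \<O> ` (\<O> ` \<Lambda>)"
  define \<rho> where "\<rho> i = (if i \<in> J then \<sigma> (\<O> i) else (\<lambda>_. 0))" for i
  have J: "J \<subseteq> \<Lambda>" by (auto simp: J_def intro: inv_into_into)
  have inj: "inj_on \<O> J"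
    by (auto simp: J_def inj_on_def f_inv_into_f)
  have im: "\<O> ` J = \<O> ` \<Lambda>"
    unfolding J_def image_image by (rule image_cong) (simp_all add: f_inv_into_f)
  have s0: "supp X (\<lambda>_. 0) = {}" by (simp add: supp_def)
  have fin: "finite {i \<in> \<Lambda>. supp X (\<rho> i) \<inter> W \<noteq> {}}"
    if "finite {U \<in> \<O> ` \<Lambda>. supp X (\<sigma> U) \<inter> W \<noteq> {}}" for W
  proof -
    have "{i \<in> \<Lambda>. supp X (\<rho> i) \<inter> W \<noteq> {}} = {i \<in> J. supp X (\<sigma> (\<O> i)) \<inter> W \<noteq> {}}"
      using J by (auto simp: \<rho>_def s0)
    moreover have "finite {i \<in> J. supp X (\<sigma> (\<O> i)) \<inter> W \<noteq> {}}"
    proof (rule finite_imageD)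
      show "inj_on \<O> {i \<in> J. supp X (\<sigma> (\<O> i)) \<inter> W \<noteq> {}}"
        using inj by (rule inj_on_subset) auto
      show "finite (\<O> ` {i \<in> J. supp X (\<sigma> (\<O> i)) \<inter> W \<noteq> {}})"
        by (rule finite_subset[OF _ that]) (use J in auto)
    qed
    ultimately show ?thesis by simp
  qed
  have sum: "(\<Sum>i | i \<in> \<Lambda> \<and> \<rho> i y \<noteq> 0. \<rho> i y) = (\<Sum>U | U \<in> \<O> ` \<Lambda> \<and> \<sigma> U y \<noteq> 0. \<sigma> U y)" for y
  proof -
    have "{i. i \<in> \<Lambda> \<and> \<rho> i y \<noteq> 0} = {i \<in> J. \<sigma> (\<O> i) y \<noteq> 0}"
      using J by (auto simp: \<rho>_def)
    then have "(\<Sum>i | i \<in> \<Lambda> \<and> \<rho> i y \<noteq> 0. \<rho> i y) = (\<Sum>i\<in>{i \<in> J. \<sigma> (\<O> i) y \<noteq> 0}. \<sigma> (\<O> i) y)"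
      by (auto intro: sum.cong simp: \<rho>_def)
    also have "\<dots> = (\<Sum>U\<in>\<O> ` {i \<in> J. \<sigma> (\<O> i) y \<noteq> 0}. \<sigma> U y)"
      by (subst sum.reindex) (auto intro: inj_on_subset[OF inj])
    also have "\<O> ` {i \<in> J. \<sigma> (\<O> i) y \<noteq> 0} = {U. U \<in> \<O> ` \<Lambda> \<and> \<sigma> U y \<noteq> 0}"
      unfolding im[symmetric] by auto
    finally show ?thesis .
  qed
  have "C1_partition_of_unity X A \<Lambda> \<O> \<rho>"
    unfolding C1_partition_of_unity_def
  proof (intro conjI ballI)
    fix i assume "i \<in> \<Lambda>"
    then show "\<rho> i \<in> C1_functions A" "\<rho> i ` topspace X \<subseteq> {0..1}" "supp X (\<rho> i) \<subseteq> \<O> i"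
      using \<sigma> by (auto simp: C1_partition_of_unity_def \<rho>_def s0 zero_in_C1_functions)
  next
    fix y assume "y \<in> topspace X"
    then show "\<exists>W. openin X W \<and> y \<in> W \<and> finite {i \<in> \<Lambda>. supp X (\<rho> i) \<inter> W \<noteq> {}}"
      using \<sigma> fin unfolding C1_partition_of_unity_def by blast
  next
    fix y assume "y \<in> topspace X"
    then show "(\<Sum>i | i \<in> \<Lambda> \<and> \<rho> i y \<noteq> 0. \<rho> i y) = 1"
      using \<sigma> by (simp add: sum C1_partition_of_unity_def)
  qed
  then show ?thesis by blast
qed


section \<open>Well-definedness of tangent vectors and derivatives\<close>

lemma has_derivative_change_chart:
  fixes A :: "('m, 'e::banach) chart set" and g :: "'m \<Rightarrow> 'b::real_normed_vector"
  assumes M: "C1_banach_manifold X A" and c: "c \<in> A" "x \<in> fst c" and d: "d \<in> A" "x \<in> fst d"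
    and g: "(in_chart d g has_derivative G) (at (snd d x))"
  shows "(in_chart c g has_derivative
           G \<circ> frechet_derivative (in_chart c (snd d)) (at (snd c x))) (at (snd c x))"
proof -
  obtain U \<kappa> where cU: "c = (U, \<kappa>)" by force
  obtain V \<mu> where dV: "d = (V, \<mu>)" by force
  have hc: "openin X U" "open (\<kappa> ` U)" "homeomorphic_map (subtopology X U) (top_of_set (\<kappa> ` U)) \<kappa>"
    using M c by (auto simp: C1_banach_manifold_def chart_on_def cU)
  have hd: "openin X V" "homeomorphic_map (subtopology X V) (top_of_set (\<mu> ` V)) \<mu>"
    using M d by (auto simp: C1_banach_manifold_def chart_on_def dV)
  have injU: "inj_on \<kappa> U" and injV: "inj_on \<mu> V"
    using homeomorphic_imp_injective_map[OF hc(3)] homeomorphic_imp_injective_map[OF hd(2)]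
      openin_subset[OF hc(1)] openin_subset[OF hd(1)]
    by (simp_all add: Int_absorb1)
  have "openin (top_of_set (\<kappa> ` U)) (\<kappa> ` (U \<inter> V))"
    using homeomorphic_imp_open_map[OF hc(3)] hc(1) hd(1)
    by (auto simp: open_map_def openin_open_subtopology openin_Int)
  then have op: "open (\<kappa> ` (U \<inter> V))"
    using hc(2) openin_open_trans by blast
  have "C1_on (in_chart c (snd d)) (snd c ` (fst c \<inter> fst d))"
    using M c d unfolding C1_banach_manifold_def by blast
  then have "in_chart c (snd d) differentiable at (snd c x)"
    using c d unfolding C1_on_def differentiable_def by blast
  then have "in_chart c \<mu> differentiable at (\<kappa> x)"
    by (simp add: cU dV)
  then have tr: "(in_chart c \<mu> has_derivative frechet_derivative (in_chart c \<mu>) (at (\<kappa> x))) (at (\<kappa> x))"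
    using frechet_derivative_works by blast
  have "in_chart c \<mu> (\<kappa> x) = \<mu> x"
    using c injU by (simp add: in_chart_def cU)
  with g have "(in_chart d g has_derivative G) (at (in_chart c \<mu> (\<kappa> x)))"
    by (simp add: dV)
  from diff_chain_at[OF tr this]
  have *: "(in_chart d g \<circ> in_chart c \<mu> has_derivative
      G \<circ> frechet_derivative (in_chart c \<mu>) (at (\<kappa> x))) (at (\<kappa> x))" .
  have "(in_chart c g has_derivative
      G \<circ> frechet_derivative (in_chart c \<mu>) (at (\<kappa> x))) (at (\<kappa> x))"
    by (rule has_derivative_transform_within_open[OF * op])
      (use c d injU injV in \<open>auto simp: in_chart_def cU dV\<close>)
  then show ?thesis by (simp add: cU dV)
qed

lemma frechet_derivative_chart_self:
  fixes A :: "('m, 'e::banach) chart set"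
  assumes M: "C1_banach_manifold X A" and c: "c \<in> A" "x \<in> fst c"
  shows "(in_chart c (snd c) has_derivative (\<lambda>v. v)) (at (snd c x))"
proof (rule has_derivative_transform_within_open[where f = "\<lambda>p. p" and s = "snd c ` fst c"])
  show "open (snd c ` fst c)"
    using M c by (auto simp: C1_banach_manifold_def chart_on_def split: prod.splits)
qed (use c in \<open>auto simp: in_chart_def f_inv_into_f\<close>)

lemma chart_differentiable:
  assumes M: "C1_banach_manifold X A" and c: "c \<in> A" "x \<in> fst c" and d: "d \<in> A" "x \<in> fst d"
  shows "(in_chart c (snd d) has_derivative
    frechet_derivative (in_chart c (snd d)) (at (snd c x))) (at (snd c x))"
  using has_derivative_change_chart[OF M c d frechet_derivative_chart_self[OF M d]]
  by (simp add: o_def)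

lemma equiv_tangent_rel:
  fixes A :: "('m, 'e::banach) chart set"
  assumes M: "C1_banach_manifold X A"
  shows "equiv ({c \<in> A. x \<in> fst c} \<times> UNIV) (tangent_rel A x)"
proof -
  let ?D = "\<lambda>c d. frechet_derivative (in_chart c (snd d)) (at (snd c x))"
  have D: "?D c e v = ?D d e (?D c d v)"
    if "c \<in> A" "x \<in> fst c" "d \<in> A" "x \<in> fst d" "e \<in> A" "x \<in> fst e" for c d e v
    using frechet_derivative_at[OF has_derivative_change_chart[OF M that(1-4)
        chart_differentiable[OF M that(3-6)]], symmetric] by simp
  have D1: "?D c c v = v" if "c \<in> A" "x \<in> fst c" for c v
    using frechet_derivative_at[OF frechet_derivative_chart_self[OF M that], symmetric] by simp
  show ?thesis
  proof (rule equivI)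
    show "tangent_rel A x \<subseteq> ({c \<in> A. x \<in> fst c} \<times> UNIV) \<times> ({c \<in> A. x \<in> fst c} \<times> UNIV)"
      by (auto simp: tangent_rel_def)
    show "refl_on ({c \<in> A. x \<in> fst c} \<times> UNIV) (tangent_rel A x)"
    proof (rule refl_onI)
      fix p assume "p \<in> {c \<in> A. x \<in> fst c} \<times> (UNIV :: 'e set)"
      then obtain c v where "p = (c, v)" "c \<in> A" "x \<in> fst c" by blast
      then show "(p, p) \<in> tangent_rel A x"
        using D1[of c v] unfolding tangent_rel_def by blast
    qed
    show "sym (tangent_rel A x)"
    proof (rule symI)
      fix p q assume "(p, q) \<in> tangent_rel A x"
      then obtain c v d w where pq: "p = (c, v)" "q = (d, w)"
        and A: "c \<in> A" "d \<in> A" "x \<in> fst c" "x \<in> fst d" and w: "?D c d v = w"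
        unfolding tangent_rel_def by blast
      have "?D d c w = v"
        using D[OF A(1,3,2,4,1,3), of v] D1[OF A(1,3), of v] unfolding w by metis
      then show "(q, p) \<in> tangent_rel A x"
        using A unfolding pq tangent_rel_def by blast
    qed
    show "trans (tangent_rel A x)"
    proof (rule transI)
      fix p q r assume "(p, q) \<in> tangent_rel A x" "(q, r) \<in> tangent_rel A x"
      then obtain c v d w e u where pqr: "p = (c, v)" "q = (d, w)" "r = (e, u)"
        and A: "c \<in> A" "x \<in> fst c" "d \<in> A" "x \<in> fst d" "e \<in> A" "x \<in> fst e"
        and w: "?D c d v = w" and u: "?D d e w = u"
        unfolding tangent_rel_def by blast
      have "?D c e v = u"
        using D[OF A, of v] unfolding w u .
      then show "(p, r) \<in> tangent_rel A x"
        using A unfolding pqr tangent_rel_def by blast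
    qed
  qed
qed

lemma C1_functions_differentiable:
  assumes "\<phi> \<in> C1_functions A" "c \<in> A" "x \<in> fst c"
  shows "(in_chart c \<phi> has_derivative frechet_derivative (in_chart c \<phi>) (at (snd c x))) (at (snd c x))"
proof -
  have "in_chart c \<phi> differentiable at (snd c x)"
    using assms unfolding C1_functions_def C1_on_def differentiable_def by blast
  then show ?thesis using frechet_derivative_works by blast
qed

lemma manifold_derivative_tangent_vector:
  fixes A :: "('m, 'e::banach) chart set"
  assumes M: "C1_banach_manifold X A" and \<phi>: "\<phi> \<in> C1_functions A" and c: "c \<in> A" "x \<in> fst c"
  shows "manifold_derivative A \<phi> x (tangent_vector A x c v)
    = frechet_derivative (in_chart c \<phi>) (at (snd c x)) v"
proof -
  have mem: "(c, v) \<in> tangent_vector A x c v"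
    using equiv_class_self[OF equiv_tangent_rel[OF M], of "(c, v)" x] c
    by (simp add: tangent_vector_def)
  have "tangent_vector A x c v \<in> tangent_space A x"
    unfolding tangent_vector_def tangent_space_def using c by (auto intro: quotientI)
  moreover have same: "frechet_derivative (in_chart c \<phi>) (at (snd c x)) v
      = frechet_derivative (in_chart d \<phi>) (at (snd d x)) w"
    if "(d, w) \<in> tangent_vector A x c v" for d w
  proof -
    from that have d: "d \<in> A" "x \<in> fst d"
      and w: "frechet_derivative (in_chart c (snd d)) (at (snd c x)) v = w"
      by (auto simp: tangent_vector_def tangent_rel_def)
    show ?thesis
      using frechet_derivative_at[OF has_derivative_change_chart[OF M c d
          C1_functions_differentiable[OF \<phi> d]], symmetric] w by simp
  qed
  moreover have "(THE r. \<forall>(d, w)\<in>tangent_vector A x c v.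
      r = frechet_derivative (in_chart d \<phi>) (at (snd d x)) w)
    = frechet_derivative (in_chart c \<phi>) (at (snd c x)) v"
    by (rule the_equality) (use mem same in blast)+
  ultimately show ?thesis
    unfolding manifold_derivative_def by (simp only: restrict_apply')
qed

lemma manifold_derivative_in_cotangent_space:
  assumes M: "C1_banach_manifold X A" and \<phi>: "\<phi> \<in> C1_functions A"
  shows "manifold_derivative A \<phi> x \<in> cotangent_space A x"
proof -
  have "manifold_derivative A \<phi> x \<in> extensional (tangent_space A x)"
    by (simp add: manifold_derivative_def)
  then show ?thesis
    unfolding cotangent_space_def
    using has_derivative_bounded_linear[OF C1_functions_differentiable[OF \<phi>]]
    by (auto simp only: manifold_derivative_tangent_vector[OF M \<phi>] mem_Collect_eq)
qed

lemma frechet_subdifferential_subset_cotangent_space: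
  assumes "C1_banach_manifold X A"
  shows "frechet_subdifferential X A f x \<subseteq> cotangent_space A x"
  using manifold_derivative_in_cotangent_space[OF assms]
  by (auto simp: frechet_subdifferential_def)

end

(* Cover the manifold by a neighbourhood of x on which the local minimum is attained and, for
   every other point y, by an open set that avoids x and on which f exceeds a real constant;
   lower semi-continuity provides the latter.  A partition of unity glues \<phi> + f x - \<phi> x and these
   constants into a minorant of f that agrees with \<phi> + f x - \<phi> x near x. *)
theory Submission
  imports Defs
begin

section \<open>Calculus of C1 maps\<close>

lemma C1_on_const: "C1_on (\<lambda>_. k) S"
  unfolding C1_on_def
  by (rule exI[of _ "\<lambda>_. 0"]) (auto intro!: derivative_eq_intros)

lemma C1_on_add:
  assumes "C1_on g S" "C1_on h S"
  shows "C1_on (\<lambda>p. g p + h p) S"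
proof -
  obtain g' h' where
    g: "\<And>p. p \<in> S \<Longrightarrow> (g has_derivative blinfun_apply (g' p)) (at p)" "continuous_on S g'" and
    h: "\<And>p. p \<in> S \<Longrightarrow> (h has_derivative blinfun_apply (h' p)) (at p)" "continuous_on S h'"
    using assms unfolding C1_on_def by blast
  have "((\<lambda>p. g p + h p) has_derivative blinfun_apply (g' p + h' p)) (at p)" if "p \<in> S" for p
    using has_derivative_add[OF g(1)[OF that] h(1)[OF that]] by (simp add: plus_blinfun.rep_eq)
  moreover have "continuous_on S (\<lambda>p. g' p + h' p)"
    using g(2) h(2) by (rule continuous_on_add)
  ultimately show ?thesis
    unfolding C1_on_def by (intro exI[of _ "\<lambda>p. g' p + h' p"]) simp
qed

lemma C1_on_mult:
  fixes g h :: "'a::real_normed_vector \<Rightarrow> real"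
  assumes "C1_on g S" "C1_on h S"
  shows "C1_on (\<lambda>p. g p * h p) S"
proof -
  obtain g' h' where
    g: "\<And>p. p \<in> S \<Longrightarrow> (g has_derivative blinfun_apply (g' p)) (at p)" "continuous_on S g'" and
    h: "\<And>p. p \<in> S \<Longrightarrow> (h has_derivative blinfun_apply (h' p)) (at p)" "continuous_on S h'"
    using assms unfolding C1_on_def by blast
  let ?D = "\<lambda>p. g p *\<^sub>R h' p + h p *\<^sub>R g' p"
  have "continuous_on S g" "continuous_on S h"
    using g(1) h(1)
    by (meson continuous_at_imp_continuous_on has_derivative_continuous)+
  then have "continuous_on S ?D"
    using g(2) h(2) by (intro continuous_on_add continuous_on_scaleR)
  moreover have "((\<lambda>p. g p * h p) has_derivative blinfun_apply (?D p)) (at p)" if "p \<in> S" for p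
    using has_derivative_mult[OF g(1)[OF that] h(1)[OF that]]
    by (simp add: plus_blinfun.rep_eq scaleR_blinfun.rep_eq mult.commute)
  ultimately show ?thesis
    unfolding C1_on_def by (intro exI[of _ ?D]) simp
qed

text \<open>\<open>C1_on\<close> takes derivatives at points of the whole space, so openness of
  \<open>S\<close> is what makes agreement on \<open>S\<close> agreement near each of its
  points.\<close>

lemma C1_on_cong:
  assumes "C1_on g S" "open S" "\<And>p. p \<in> S \<Longrightarrow> g p = h p"
  shows "C1_on h S"
proof -
  obtain g' where
    g: "\<And>p. p \<in> S \<Longrightarrow> (g has_derivative blinfun_apply (g' p)) (at p)" "continuous_on S g'"
    using assms(1) unfolding C1_on_def by blast
  have "(h has_derivative blinfun_apply (g' p)) (at p)" if "p \<in> S" for p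
    by (rule has_derivative_transform_within_open[OF g(1)[OF that] assms(2) that assms(3)])
  then show ?thesis
    using g(2) unfolding C1_on_def by blast
qed

lemma C1_on_subset: "C1_on g T \<Longrightarrow> S \<subseteq> T \<Longrightarrow> C1_on g S"
  unfolding C1_on_def by (meson continuous_on_subset subset_eq)

text \<open>Frechet derivatives at a point are unique, so the derivatives supplied on different
  neighbourhoods agree on overlaps and combine into one map.\<close>

lemma C1_on_locally:
  assumes "\<And>p. p \<in> S \<Longrightarrow> \<exists>T. open T \<and> p \<in> T \<and> C1_on g T"
  shows "C1_on g S"
proof -
  \<comment> \<open>This candidate depends on \<open>g\<close> and \<open>p\<close> alone; it equals
    each local derivative \<open>D\<close> on its set \<open>T\<close> and so inherits continuity
    there.\<close>
  define g' where "g' p = Blinfun (frechet_derivative g (at p))" for p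
  have loc: "\<exists>T. open T \<and> p \<in> T \<and> continuous_on T g'
      \<and> (g has_derivative blinfun_apply (g' p)) (at p)" if p: "p \<in> S" for p
  proof -
    obtain T D where T: "open T" "p \<in> T" "continuous_on T D"
      and D: "\<And>q. q \<in> T \<Longrightarrow> (g has_derivative blinfun_apply (D q)) (at q)"
      using assms[OF p] unfolding C1_on_def by blast
    have eq: "g' q = D q" if "q \<in> T" for q
      using frechet_derivative_at[OF D[OF that], symmetric]
      by (simp add: g'_def blinfun_apply_inverse)
    have "continuous_on T g'"
      using T(3) eq by (simp cong: continuous_on_cong)
    then show ?thesis
      using T D eq by metis
  qed
  have "continuous_on S g'"
  proof (rule continuous_at_imp_continuous_on, rule ballI)
    fix p assume "p \<in> S"
    then show "isCont g' p"
      using loc continuous_on_eq_continuous_at by blast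
  qed
  then show ?thesis
    unfolding C1_on_def using loc by blast
qed

section \<open>C1 functions on a manifold\<close>

lemma chart_properties:
  assumes "C1_banach_manifold X A" "c \<in> A"
  shows "openin X (fst c)" "open (snd c ` fst c)"
    "homeomorphic_map (subtopology X (fst c)) (top_of_set (snd c ` fst c)) (snd c)"
  using assms by (auto simp: C1_banach_manifold_def chart_on_def case_prod_beta)

text \<open>This turns neighbourhoods on the manifold into neighbourhoods in coordinates: a chart is
  a homeomorphism onto its image, and that image is open in the model space.\<close>

lemma open_image_chart:
  assumes M: "C1_banach_manifold X A" and c: "c \<in> A" and W: "openin X W"
  shows "open (snd c ` (fst c \<inter> W))"
proof -
  note c = chart_properties[OF M c]
  have "openin (top_of_set (snd c ` fst c)) (snd c ` (fst c \<inter> W))"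
    using homeomorphic_imp_open_map[OF c(3)] c(1) W
    by (auto simp: open_map_def openin_open_subtopology openin_Int)
  then show ?thesis
    using c(2) openin_open_trans by blast
qed

lemma inj_on_chart:
  assumes M: "C1_banach_manifold X A" and c: "c \<in> A"
  shows "inj_on (snd c) (fst c)"
proof -
  note c = chart_properties[OF M c]
  show ?thesis
    using homeomorphic_imp_injective_map[OF c(3)] openin_subset[OF c(1)]
    by (simp add: Int_absorb1)
qed

lemma in_chart_apply:
  assumes "C1_banach_manifold X A" "c \<in> A" "z \<in> fst c"
  shows "in_chart c g (snd c z) = g z"
  using inj_on_chart[OF assms(1,2)] assms(3) by (simp add: in_chart_def)

text \<open>The manifold need not be Hausdorff, but each chart domain is, which suffices for T1.\<close>

lemma C1_banach_manifold_imp_t1_space: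
  assumes M: "C1_banach_manifold X A"
  shows "t1_space X"
  unfolding t1_space_openin_delete_alt
proof (intro allI impI)
  fix U x assume U: "openin X U"
  show "openin X (U - {x})"
  proof (subst openin_subopen, intro ballI)
    fix y assume y: "y \<in> U - {x}"
    then obtain c where c: "c \<in> A" "y \<in> fst c"
      using M openin_subset[OF U] unfolding C1_banach_manifold_def by blast
    note c' = chart_properties[OF M c(1)]
    have "t1_space (top_of_set (snd c ` fst c))"
      by (simp add: Hausdorff_imp_t1_space Hausdorff_space_subtopology)
    then have "t1_space (subtopology X (fst c))"
      using homeomorphic_t1_space c'(3) homeomorphic_map_imp_homeomorphic_space by blast
    \<comment> \<open>The T1 characterization quantifies over all \<open>x\<close>, so it also
      covers the case where \<open>x\<close> lies outside this chart.\<close>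
    then have "openin (subtopology X (fst c)) ((fst c \<inter> U) - {x})"
      using c'(1) U by (auto simp: t1_space_openin_delete_alt openin_open_subtopology)
    then have "openin X ((fst c \<inter> U) - {x})"
      using c'(1) openin_trans_full by blast
    then show "\<exists>T. openin X T \<and> y \<in> T \<and> T \<subseteq> U - {x}"
      using c y by blast
  qed
qed

lemma C1_functions_const: "(\<lambda>_. k) \<in> C1_functions A"
  by (simp add: C1_functions_def in_chart_def o_def C1_on_const)

lemma C1_functions_add:
  "g \<in> C1_functions A \<Longrightarrow> h \<in> C1_functions A \<Longrightarrow> (\<lambda>y. g y + h y) \<in> C1_functions A"
  unfolding C1_functions_def in_chart_def o_def
  by (intro CollectI ballI C1_on_add) simp_all

lemma C1_functions_mult:
  "g \<in> C1_functions A \<Longrightarrow> h \<in> C1_functions A \<Longrightarrow> (\<lambda>y. g y * h y) \<in> C1_functions A"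
  unfolding C1_functions_def in_chart_def o_def
  by (intro CollectI ballI C1_on_mult) simp_all

lemma C1_functions_sum:
  "(\<And>i. i \<in> F \<Longrightarrow> g i \<in> C1_functions A) \<Longrightarrow> (\<lambda>y. \<Sum>i\<in>F. g i y) \<in> C1_functions A"
  \<comment> \<open>A sum over an infinite \<open>F\<close> is 0 by convention, hence a constant
    function.\<close>
  by (induction F rule: infinite_finite_induct)
     (simp_all add: C1_functions_const C1_functions_add)

text \<open>Meant for locally finite sums, where the finite sum \<open>h\<close> changes with the
  point. Regularity in a chart is checked near each point of its image.\<close>

lemma C1_functions_locally:
  assumes M: "C1_banach_manifold X A"
    and loc: "\<And>y. y \<in> topspace X \<Longrightarrow>
      \<exists>W h. openin X W \<and> y \<in> W \<and> h \<in> C1_functions A \<and> (\<forall>z\<in>W. g z = h z)"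
  shows "g \<in> C1_functions A"
  unfolding C1_functions_def
proof (intro CollectI ballI, rule C1_on_locally)
  fix c p assume c: "c \<in> A" and "p \<in> snd c ` fst c"
  then obtain y where y: "y \<in> fst c" "p = snd c y" by blast
  have "y \<in> topspace X"
    using M c y(1) unfolding C1_banach_manifold_def by blast
  from loc[OF this] obtain W h where W: "openin X W" "y \<in> W"
    and h: "h \<in> C1_functions A" "\<And>z. z \<in> W \<Longrightarrow> g z = h z"
    by blast
  let ?T = "snd c ` (fst c \<inter> W)"
  have "C1_on (in_chart c h) ?T"
    using h(1) c by (auto simp: C1_functions_def intro: C1_on_subset)
  then have "C1_on (in_chart c g) ?T"
    by (rule C1_on_cong) (use open_image_chart[OF M c W(1)] h(2) in \<open>auto simp: in_chart_apply[OF M c]\<close>)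
  then show "\<exists>T. open T \<and> p \<in> T \<and> C1_on (in_chart c g) T"
    using open_image_chart[OF M c W(1)] y W(2) by blast
qed

section \<open>Locality of the derivative and attained conjugates\<close>

lemma manifold_derivative_eq_locally:
  assumes M: "C1_banach_manifold X A" and \<phi>: "\<phi> \<in> C1_functions A"
    and W: "openin X W" "x \<in> W" and eq: "\<And>z. z \<in> W \<Longrightarrow> \<psi> z = \<phi> z + k"
  shows "manifold_derivative A \<psi> x = manifold_derivative A \<phi> x"
proof -
  have same: "frechet_derivative (in_chart c \<psi>) (at (snd c x))
      = frechet_derivative (in_chart c \<phi>) (at (snd c x))" if c: "c \<in> A" "x \<in> fst c" for c
  proof -
    let ?D = "frechet_derivative (in_chart c \<phi>) (at (snd c x))"
    have "((\<lambda>p. in_chart c \<phi> p + k) has_derivative ?D) (at (snd c x))"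
      using C1_functions_differentiable[OF \<phi> c] by (auto intro!: derivative_eq_intros)
    then have "(in_chart c \<psi> has_derivative ?D) (at (snd c x))"
      by (rule has_derivative_transform_within_open[OF _ open_image_chart[OF M c(1) W(1)]])
         (use c W eq in \<open>auto simp: in_chart_apply[OF M c(1)]\<close>)
    then show ?thesis
      using frechet_derivative_at by metis
  qed
  \<comment> \<open>The predicates under \<open>THE\<close> in the two derivatives coincide: a
    tangent vector at \<open>x\<close> contains only pairs whose chart is in \<open>A\<close> and
    around \<open>x\<close>, where \<open>same\<close> applies.\<close>
  have "(\<forall>(c, v)\<in>\<xi>. r = frechet_derivative (in_chart c \<psi>) (at (snd c x)) v) \<longleftrightarrow>
        (\<forall>(c, v)\<in>\<xi>. r = frechet_derivative (in_chart c \<phi>) (at (snd c x)) v)"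
    if "\<xi> \<in> tangent_space A x" for \<xi> r
  proof -
    have "c \<in> A \<and> x \<in> fst c" if "(c, v) \<in> \<xi>" for c v
      using \<open>\<xi> \<in> tangent_space A x\<close> that
      by (auto simp: tangent_space_def quotient_def tangent_rel_def)
    then show ?thesis
      using same by (intro ball_cong) auto
  qed
  then show ?thesis
    unfolding manifold_derivative_def by (intro restrict_ext) simp
qed

lemma fenchel_conjugate_attained:
  assumes "x \<in> topspace X" "\<And>y. y \<in> topspace X \<Longrightarrow> ereal (\<phi> y) - h y \<le> ereal (\<phi> x) - h x"
  shows "fenchel_conjugate X h \<phi> = ereal (\<phi> x) - h x"
  unfolding fenchel_conjugate_def
  by (rule antisym) (use assms in \<open>auto intro: SUP_least SUP_upper\<close>)

section \<open>Gluing by a partition of unity\<close>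

text \<open>Average of the local functions \<open>g i\<close> with weights \<open>\<rho> i\<close>.
  Dropping zero weights leaves finitely many terms at each point of the manifold when
  \<open>\<rho>\<close> is a partition of unity; an infinite index set would make the sum 0 by
  convention.\<close>

definition glue :: "'i set \<Rightarrow> ('i \<Rightarrow> 'm \<Rightarrow> real) \<Rightarrow> ('i \<Rightarrow> 'm \<Rightarrow> real) \<Rightarrow> 'm \<Rightarrow> real" where
  "glue \<Lambda> \<rho> g z = (\<Sum>i | i \<in> \<Lambda> \<and> \<rho> i z \<noteq> 0. \<rho> i z * g i z)"

lemma in_supp: "z \<in> topspace X \<Longrightarrow> \<rho> z \<noteq> 0 \<Longrightarrow> z \<in> supp X \<rho>"
  unfolding supp_def using closure_of_subset[of "{y \<in> topspace X. \<rho> y \<noteq> 0}" X] by auto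

lemma glue_C1_functions:
  assumes M: "C1_banach_manifold X A" and P: "C1_partition_of_unity X A \<Lambda> \<O> \<rho>"
    and g: "\<And>i. i \<in> \<Lambda> \<Longrightarrow> g i \<in> C1_functions A"
  shows "glue \<Lambda> \<rho> g \<in> C1_functions A"
proof (rule C1_functions_locally[OF M])
  fix y assume "y \<in> topspace X"
  then obtain W where W: "openin X W" "y \<in> W"
    and fin: "finite {i \<in> \<Lambda>. supp X (\<rho> i) \<inter> W \<noteq> {}}" (is "finite ?F")
    using P unfolding C1_partition_of_unity_def by blast
  \<comment> \<open>The index set of \<open>glue\<close> varies with \<open>z\<close>. For
    \<open>z\<close> in \<open>W\<close> it stays inside the fixed finite set \<open>?F\<close>, and
    the terms added to reach \<open>?F\<close> vanish.\<close>
  have "glue \<Lambda> \<rho> g z = (\<Sum>i\<in>?F. \<rho> i z * g i z)" if "z \<in> W" for z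
    unfolding glue_def
  proof (rule sum.mono_neutral_left[OF fin])
    show "{i. i \<in> \<Lambda> \<and> \<rho> i z \<noteq> 0} \<subseteq> ?F"
      using that in_supp openin_subset[OF W(1)] by fastforce
  qed auto
  moreover have "(\<lambda>z. \<Sum>i\<in>?F. \<rho> i z * g i z) \<in> C1_functions A"
    using P g by (auto intro!: C1_functions_sum C1_functions_mult simp: C1_partition_of_unity_def)
  ultimately show "\<exists>W h. openin X W \<and> y \<in> W \<and> h \<in> C1_functions A \<and> (\<forall>z\<in>W. glue \<Lambda> \<rho> g z = h z)"
    using W by blast
qed

text \<open>A nonzero weight at \<open>z\<close> puts \<open>z\<close> in the corresponding
  \<open>\<O> i\<close>. Hence the glued value is a convex combination of numbers that are all at
  most \<open>f z\<close>.\<close>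

lemma glue_le:
  assumes P: "C1_partition_of_unity X A \<Lambda> \<O> \<rho>" and z: "z \<in> topspace X"
    and le: "\<And>i. i \<in> \<Lambda> \<Longrightarrow> z \<in> \<O> i \<Longrightarrow> ereal (g i z) \<le> f z"
  shows "ereal (glue \<Lambda> \<rho> g z) \<le> f z"
proof -
  let ?F = "{i. i \<in> \<Lambda> \<and> \<rho> i z \<noteq> 0}"
  have F: "ereal (g i z) \<le> f z" "\<rho> i z \<ge> 0" if i: "i \<in> ?F" for i
  proof -
    have "supp X (\<rho> i) \<subseteq> \<O> i" "\<rho> i z \<in> {0..1}"
      using P i z unfolding C1_partition_of_unity_def by blast+
    then show "ereal (g i z) \<le> f z" "\<rho> i z \<ge> 0"
      using i le in_supp[OF z] by auto
  qed
  have one: "(\<Sum>i\<in>?F. \<rho> i z) = 1"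
    using P z by (simp add: C1_partition_of_unity_def)
  \<comment> \<open>Weights summing to 1 cannot all vanish, so some real \<open>g i z\<close> lies
    below \<open>f z\<close> and excludes the value minus infinity.\<close>
  then have "?F \<noteq> {}"
    by (metis sum.empty zero_neq_one)
  then have "f z \<noteq> -\<infinity>"
    using F(1) by force
  then consider "f z = \<infinity>" | r where "f z = ereal r"
    by (cases "f z") auto
  then show ?thesis
  proof cases
    case (2 r)
    have "glue \<Lambda> \<rho> g z \<le> (\<Sum>i\<in>?F. \<rho> i z * r)"
      unfolding glue_def using F 2 by (intro sum_mono mult_left_mono) auto
    also have "\<dots> = r"
      using one by (simp flip: sum_distrib_right)
    finally show ?thesis
      using 2 by simp
  qed simp
qed

text \<open>
  Near a point lying in only one set of the cover, local finiteness and closedness of the supports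
  make all but one of the functions of the partition vanish.
\<close>

lemma glue_eq_near:
  assumes P: "C1_partition_of_unity X A \<Lambda> \<O> \<rho>" and x: "x \<in> topspace X"
    and j: "j \<in> \<Lambda>" "\<And>i. i \<in> \<Lambda> \<Longrightarrow> x \<in> \<O> i \<Longrightarrow> i = j"
  shows "\<exists>W. openin X W \<and> x \<in> W \<and> (\<forall>z\<in>W. glue \<Lambda> \<rho> g z = g j z)"
proof -
  obtain W where W: "openin X W" "x \<in> W"
    and fin: "finite {i \<in> \<Lambda>. supp X (\<rho> i) \<inter> W \<noteq> {}}" (is "finite ?F")
    using P x unfolding C1_partition_of_unity_def by blast
  \<comment> \<open>The supports other than that of \<open>j\<close> that meet \<open>W\<close>.
    Their union is closed because it is finite, and it misses \<open>x\<close> because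
    \<open>\<O> j\<close> is the only member of the cover that can contain \<open>x\<close>.\<close>
  define K where "K = (\<Union>i\<in>?F - {j}. supp X (\<rho> i))"
  have "closedin X K"
    unfolding K_def using fin by (intro closedin_Union) (auto simp: supp_def)
  then have "openin X (W - K)"
    using W(1) by (rule openin_diff[rotated])
  moreover have "x \<in> W - K"
    using W(2) P j(2) unfolding K_def C1_partition_of_unity_def by blast
  moreover have "glue \<Lambda> \<rho> g z = g j z" if z: "z \<in> W - K" for z
  proof -
    have top: "z \<in> topspace X"
      using z openin_subset[OF W(1)] by blast
    have "{i. i \<in> \<Lambda> \<and> \<rho> i z \<noteq> 0} \<subseteq> {j}"
      using z in_supp[OF top] unfolding K_def by blast
    moreover have one: "(\<Sum>i | i \<in> \<Lambda> \<and> \<rho> i z \<noteq> 0. \<rho> i z) = 1"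
      using P top by (simp add: C1_partition_of_unity_def)
    \<comment> \<open>An empty index set would give the sum 0. So \<open>j\<close> is the only index
      left, and its weight is 1.\<close>
    ultimately have "{i. i \<in> \<Lambda> \<and> \<rho> i z \<noteq> 0} = {j}"
      by (metis subset_singletonD sum.empty zero_neq_one)
    then show ?thesis
      using one by (simp add: glue_def)
  qed
  ultimately show ?thesis by blast
qed

section \<open>Global C1 minorants of lower semi-continuous functions\<close>

lemma lower_semicontinuous_locally_bounded_below:
  assumes "lower_semicontinuous X f" "y \<in> topspace X" "f y \<noteq> -\<infinity>"
  shows "\<exists>V r. openin X V \<and> y \<in> V \<and> (\<forall>z\<in>V. ereal r \<le> f z)"
proof -
  \<comment> \<open>Such a real exists also when \<open>f y\<close> is infinite; its strict
    superlevel set is the neighbourhood sought.\<close>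
  obtain r where "ereal r < f y"
    using assms(3) ereal_dense2[of "-\<infinity>" "f y"] by auto
  then show ?thesis
    using assms(1,2) unfolding lower_semicontinuous_def
    by (intro exI[of _ "{y \<in> topspace X. f y > ereal r}"] exI[of _ r]) auto
qed

text \<open>Agreement with \<open>h\<close> on a neighbourhood, rather than at \<open>x\<close>
  alone, is what later preserves the derivative at \<open>x\<close>.\<close>

lemma minorant_extension:
  assumes M: "C1_banach_manifold X A" and PU: "admits_C1_partitions_of_unity X A"
    and x: "x \<in> topspace X" and f: "\<forall>y\<in>topspace X. f y \<noteq> -\<infinity>" "lower_semicontinuous X f"
    and h: "h \<in> C1_functions A"
    and W: "openin X W" "x \<in> W" "\<And>y. y \<in> W \<Longrightarrow> ereal (h y) \<le> f y"
  shows "\<exists>\<psi>\<in>C1_functions A. (\<forall>y\<in>topspace X. ereal (\<psi> y) \<le> f y) \<and>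
    (\<exists>V. openin X V \<and> x \<in> V \<and> (\<forall>z\<in>V. \<psi> z = h z))"
proof -
  have "\<forall>y\<in>topspace X. \<exists>V r. openin X V \<and> y \<in> V \<and> (\<forall>z\<in>V. ereal r \<le> f z)"
    using lower_semicontinuous_locally_bounded_below f by metis
  then obtain B r where B: "\<And>y. y \<in> topspace X \<Longrightarrow>
      openin X (B y) \<and> y \<in> B y \<and> (\<forall>z\<in>B y. ereal (r y) \<le> f z)"
    by metis
  \<comment> \<open>Removing \<open>x\<close> from the other sets leaves \<open>W\<close> as the
    only member containing \<open>x\<close>, as \<open>glue_eq_near\<close> requires; T1 keeps them
    open. Indexing by points attaches one local minorant \<open>g y\<close> to each member.\<close>
  define \<O> where "\<O> y = (if y = x then W else B y - {x})" for y
  define g where "g y = (if y = x then h else (\<lambda>_. r y))" for y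
  have "openin X (\<O> y)" "y \<in> \<O> y" if "y \<in> topspace X" for y
    using that B W C1_banach_manifold_imp_t1_space[OF M]
    by (auto simp: \<O>_def t1_space_openin_delete_alt)
  then have "open_cover X (topspace X) \<O>"
    using openin_subset unfolding open_cover_def by fastforce
  then obtain \<rho> where P: "C1_partition_of_unity X A (topspace X) \<O> \<rho>"
    using admits_C1_partitions_of_unity_indexed[OF PU] by blast
  define \<psi> where "\<psi> = glue (topspace X) \<rho> g"
  have "\<psi> \<in> C1_functions A"
    unfolding \<psi>_def
    by (rule glue_C1_functions[OF M P]) (simp add: g_def h C1_functions_const)
  moreover have "ereal (\<psi> y) \<le> f y" if "y \<in> topspace X" for y
    unfolding \<psi>_def
    by (rule glue_le[OF P that]) (use B W in \<open>auto simp: g_def \<O>_def split: if_splits\<close>)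
  moreover have "\<exists>V. openin X V \<and> x \<in> V \<and> (\<forall>z\<in>V. \<psi> z = g x z)"
    unfolding \<psi>_def
    by (rule glue_eq_near[OF P x x]) (auto simp: \<O>_def split: if_splits)
  ultimately show ?thesis
    by (auto simp: g_def)
qed

theorem proposition5p8:
  fixes X :: "'m topology" and A :: "('m, 'e::banach) chart set"
    and f :: "'m \<Rightarrow> ereal" and x :: 'm and x_star :: "('m, 'e) tangent \<Rightarrow> real"
  assumes "C1_banach_manifold X A"
    and "x \<in> topspace X"
    and "\<forall>y\<in>topspace X. f y \<noteq> -\<infinity>"
    and "lower_semicontinuous X f"
    and "x_star \<in> frechet_subdifferential X A f x"
  shows "(\<exists>\<phi> V. \<phi> \<in> C1_functions A \<and> openin X V \<and> x \<in> V \<and>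
            manifold_derivative A \<phi> x = x_star \<and>
            fenchel_conjugate X (\<lambda>y. f y + indicator_function V y) \<phi> = ereal (\<phi> x) - f x) \<and>
         (admits_C1_partitions_of_unity X A \<longrightarrow>
            (\<exists>\<psi>. \<psi> \<in> C1_functions A \<and> manifold_derivative A \<psi> x = x_star \<and>
                 fenchel_conjugate X f \<psi> = ereal (\<psi> x) - f x))"
proof -
  obtain \<phi> W where \<phi>: "\<phi> \<in> C1_functions A" "manifold_derivative A \<phi> x = x_star"
    and W: "openin X W" "x \<in> W"
    and min: "\<And>y. y \<in> W \<Longrightarrow> f x - ereal (\<phi> x) \<le> f y - ereal (\<phi> y)"
    and fin: "f x \<noteq> \<infinity>"
    using assms(5) unfolding frechet_subdifferential_def local_min_at_def
    by (auto split: if_splits)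
  obtain a where a: "f x = ereal a"
    using fin assms(2,3) by (cases "f x") auto
  \<comment> \<open>The shift by \<open>a - \<phi> x\<close> makes the function touch
    \<open>f\<close> at \<open>x\<close>; the local minimum then says that it is a minorant of
    \<open>f\<close> on \<open>W\<close>.\<close>
  have minW: "ereal (\<phi> y + (a - \<phi> x)) \<le> f y" if "y \<in> W" for y
    using min[OF that] by (cases "f y") (auto simp: a)
  have "fenchel_conjugate X (\<lambda>y. f y + indicator_function W y) \<phi>
      = ereal (\<phi> x) - (f x + indicator_function W x)"
  proof (rule fenchel_conjugate_attained[OF assms(2)])
    fix y assume y: "y \<in> topspace X"
    then have "f y \<noteq> -\<infinity>"
      using assms(3) by blast
    \<comment> \<open>Outside \<open>W\<close> the indicator makes the left side minus infinity;
      inside, \<open>minW\<close> applies.\<close>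
    then show "ereal (\<phi> y) - (f y + indicator_function W y)
        \<le> ereal (\<phi> x) - (f x + indicator_function W x)"
      using minW[of y] W(2) by (cases "f y") (auto simp: indicator_function_def a)
  qed
  then have 1: "fenchel_conjugate X (\<lambda>y. f y + indicator_function W y) \<phi> = ereal (\<phi> x) - f x"
    using W(2) by (simp add: indicator_function_def)
  have 2: "\<exists>\<psi>. \<psi> \<in> C1_functions A \<and> manifold_derivative A \<psi> x = x_star \<and>
      fenchel_conjugate X f \<psi> = ereal (\<psi> x) - f x" if PU: "admits_C1_partitions_of_unity X A"
  proof -
    have "(\<lambda>y. \<phi> y + (a - \<phi> x)) \<in> C1_functions A"
      by (intro C1_functions_add \<phi>(1) C1_functions_const)
    from minorant_extension[OF assms(1) PU assms(2,3,4) this W minW]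
    obtain \<psi> V where \<psi>: "\<psi> \<in> C1_functions A" "\<And>y. y \<in> topspace X \<Longrightarrow> ereal (\<psi> y) \<le> f y"
      and V: "openin X V" "x \<in> V" "\<And>z. z \<in> V \<Longrightarrow> \<psi> z = \<phi> z + (a - \<phi> x)"
      by blast
    have "manifold_derivative A \<psi> x = x_star"
      using manifold_derivative_eq_locally[OF assms(1) \<phi>(1) V] \<phi>(2) by simp
    \<comment> \<open>Since \<open>\<psi> x = a\<close>, the right side is 0 and the inequality
      restates that \<open>\<psi>\<close> is a minorant of \<open>f\<close>.\<close>
    moreover have "ereal (\<psi> y) - f y \<le> ereal (\<psi> x) - f x" if "y \<in> topspace X" for y
      using \<psi>(2)[OF that] V(2,3) by (cases "f y") (auto simp: a)
    ultimately show ?thesis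
      using \<psi>(1) fenchel_conjugate_attained[OF assms(2)] by blast
  qed
  show ?thesis
    using \<phi> W 1 2 by blast
qed

end
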